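(* Let $\mathbb{G}$, $\mathbb{U}$ and $\mathbb{S}$ be separable reflexive (real) Banach spaces, and let $a:(\mathbb{G}\times\mathbb{U})^2\to\mathbb{R}$ and $b:\mathbb{S}\times(\mathbb{G}\times\mathbb{U})\to\mathbb{R}$ be bilinear and continuous. Let $$\mathbb{Z}=\{(G,u)\in\mathbb{G}\times\mathbb{U}: b(T,(G,u))=0\ \text{ for all }T\in\mathbb{S}\},$$ and let $c:\mathbb{Z}^2\times(\mathbb{G}\times\mathbb{U})\to\mathbb{R}$ be trilinear and continuous. Assume that there are constants $c_a,c_b>0$ such that: 1. $a(\cdot,\cdot)$ is coercive on $\mathbb{Z}$: $a((G,u),(G,u))\ge c_a\|(G,u)\|^2$ for all $(G,u)\in\mathbb{Z}$. 2. $b(\cdot,\cdot)$ satisfies the inf-sup condition $$\sup_{0\ne(G,u)\in\mathbb{G}\times\mathbb{U}}\frac{b(S,(G,u))}{\|(G,u)\|}\ge c_b\|S\|_{\mathbb{S}}\qquad\text{for all }S\in\mathbb{S}.$$ 3. $c((G,u),(G,u),(G,u))=0$ for all $(G,u)\in\mathbb{Z}$, and the map $c:\mathbb{Z}\times\mathbb{Z}\to(\mathbb{G}\times\mathbb{U})'$, $(z,w)\mapsto c(z,w,\cdot)$, is weakly continuous. Then for each $F\in(\mathbb{G}\times\mathbb{U})'$ there exists $(G,u,S)\in\mathbb{G}\times\mathbb{U}\times\mathbb{S}$ such that $$a((G,u),(H,v))+c((G,u),(G,u),(H,v))-b(S,(H,v))=F(H,v)\qquad\text{for all }(H,v)\in\mathbb{G}\times\mathbb{U},$$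 $$b(T,(G,u))=0\qquad\text{for all }T\in\mathbb{S}.$$ Moreover, $$\|(G,u)\|\le\frac1{c_a}\|F\|\quad\text{and}\quad \|S\|_{\mathbb{S}}\le\frac1{c_b}\left(1+\frac{C_a}{c_a}+\frac{C_c}{c_a^2}\|F\|\right)\|F\|,$$ where $C_a$ and $C_c$ denote continuity constants of $a(\cdot,\cdot)$ and $c(\cdot,\cdot,\cdot)$ respectively.
   Context: $\|(G,u)\|$ is the norm of the product Banach space $\mathbb{G}\times\mathbb{U}$ and $\|F\|$ is the corresponding dual norm. Continuity constants: $|a(x,y)|\le C_a\|x\|\|y\|$ for $x,y\in\mathbb{G}\times\mathbb{U}$, and $|c(z,w,y)|\le C_c\|z\|\|w\|\|y\|$ for $z,w\in\mathbb{Z}$, $y\in\mathbb{G}\times\mathbb{U}$. Weakly continuous means: if $z_n\rightharpoonup z$ and $w_n\rightharpoonup w$ weakly in $\mathbb{Z}$, then $c(z_n,w_n,\cdot)\rightharpoonup c(z,w,\cdot)$ weakly in $(\mathbb{G}\times\mathbb{U})'$. *)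

theory Defs
  imports "HOL-Analysis.Analysis"
begin

text \<open>Surjectivity of the canonical embedding into the bidual.\<close>

definition reflexive_space :: "'a::real_normed_vector itself \<Rightarrow> bool" where
  "reflexive_space _ \<longleftrightarrow>
     (\<forall>\<Phi> :: ('a \<Rightarrow>\<^sub>L real) \<Rightarrow>\<^sub>L real. \<exists>x :: 'a. \<forall>f :: 'a \<Rightarrow>\<^sub>L real.
        blinfun_apply \<Phi> f = blinfun_apply f x)"

text \<open>
  Subspaces are represented as sets \<open>V\<close> of the ambient type, and functions on them as total
  functions whose values outside \<open>V\<close> are irrelevant.
\<close>

definition linear_form_on :: "'a::real_normed_vector set \<Rightarrow> ('a \<Rightarrow> real) \<Rightarrow> bool" where
  "linear_form_on V f \<longleftrightarrow>
     (\<forall>x\<in>V. \<forall>y\<in>V. f (x + y) = f x + f y) \<and> (\<forall>r. \<forall>x\<in>V. f (r *\<^sub>R x) = r * f x)"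

definition bounded_linear_form_on :: "'a::real_normed_vector set \<Rightarrow> ('a \<Rightarrow> real) \<Rightarrow> bool" where
  "bounded_linear_form_on V f \<longleftrightarrow>
     linear_form_on V f \<and> (\<exists>K. \<forall>x\<in>V. \<bar>f x\<bar> \<le> K * norm x)"

definition bounded_trilinear_form_on ::
    "'a::real_normed_vector set \<Rightarrow> 'b::real_normed_vector set \<Rightarrow> 'c::real_normed_vector set \<Rightarrow>
     ('a \<Rightarrow> 'b \<Rightarrow> 'c \<Rightarrow> real) \<Rightarrow> bool" where
  "bounded_trilinear_form_on U V W c \<longleftrightarrow>
     (\<forall>v\<in>V. \<forall>w\<in>W. linear_form_on U (\<lambda>u. c u v w)) \<and>
     (\<forall>u\<in>U. \<forall>w\<in>W. linear_form_on V (\<lambda>v. c u v w)) \<and>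
     (\<forall>u\<in>U. \<forall>v\<in>V. linear_form_on W (\<lambda>w. c u v w)) \<and>
     (\<exists>K. \<forall>u\<in>U. \<forall>v\<in>V. \<forall>w\<in>W. \<bar>c u v w\<bar> \<le> K * norm u * norm v * norm w)"

text \<open>
  Weak convergence in the normed space \<open>V\<close>: the test functionals are those of the dual of \<open>V\<close>
  itself, not only restrictions of functionals on the ambient space.
\<close>

definition weakly_converges_in ::
    "'a::real_normed_vector set \<Rightarrow> (nat \<Rightarrow> 'a) \<Rightarrow> 'a \<Rightarrow> bool" where
  "weakly_converges_in V x l \<longleftrightarrow>
     range x \<subseteq> V \<and> l \<in> V \<and>
     (\<forall>f. bounded_linear_form_on V f \<longrightarrow> (\<lambda>n. f (x n)) \<longlonglongrightarrow> f l)"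

text \<open>
  The map \<open>(z, w) \<mapsto> c(z, w, \<cdot>)\<close> into the dual. It is meant for \<open>c\<close> such that \<open>c z w\<close> is bounded
  linear for all \<open>z, w\<close> in \<open>V\<close>, so that \<open>Blinfun\<close> is meaningful. The limit on the right is
  weak (tested against the bidual), not weak-star.
\<close>

definition weakly_continuous_into_dual ::
    "'a::real_normed_vector set \<Rightarrow> ('a \<Rightarrow> 'a \<Rightarrow> 'b::real_normed_vector \<Rightarrow> real) \<Rightarrow> bool" where
  "weakly_continuous_into_dual V c \<longleftrightarrow>
     (\<forall>zs z ws w. weakly_converges_in V zs z \<longrightarrow> weakly_converges_in V ws w \<longrightarrow>
        weakly_converges_in (UNIV :: ('b \<Rightarrow>\<^sub>L real) set)
          (\<lambda>n. Blinfun (c (zs n) (ws n))) (Blinfun (c z w)))"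

definition form_kernel :: "('s \<Rightarrow> 'x \<Rightarrow> real) \<Rightarrow> 'x set" where
  "form_kernel b = {x. \<forall>T. b T x = 0}"

definition coercive_on ::
    "'x::real_normed_vector set \<Rightarrow> ('x \<Rightarrow> 'x \<Rightarrow> real) \<Rightarrow> real \<Rightarrow> bool" where
  "coercive_on V a \<alpha> \<longleftrightarrow> (\<forall>x\<in>V. a x x \<ge> \<alpha> * (norm x)\<^sup>2)"

text \<open>
  For bounded bilinear \<open>b\<close> the quotients are bounded above, so the real supremum is the
  true one as soon as the second space is nontrivial.
\<close>

definition inf_sup_condition ::
    "('s::real_normed_vector \<Rightarrow> 'x::real_normed_vector \<Rightarrow> real) \<Rightarrow> real \<Rightarrow> bool" where
  "inf_sup_condition b \<beta> \<longleftrightarrow> (\<forall>S. (SUP x\<in>-{0}. b S x / norm x) \<ge> \<beta> * norm S)"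

end

theory Submission
  imports Defs
begin

text \<open>
  On \<open>Z = form_kernel b\<close> the multiplier \<open>S\<close> disappears. There a Galerkin scheme, solvable by coercivity,
  \<open>c(z, z, z) = 0\<close> and a Brouwer-type argument, gives a bounded sequence of approximate solutions;
  reflexivity and separability yield a weak limit point, and weak continuity of \<open>c\<close> makes it a
  solution. The residual annihilates \<open>Z\<close>, hence by the inf-sup condition it is \<open>b(S, \<cdot>)\<close> for some \<open>S\<close>
  (closed range), which satisfies the stated bound.
\<close>

section \<open>Hahn--Banach\<close>

text \<open>Bounded approximations have only a weak limit point, and the quadratic term
  \<open>c(z, z, y)\<close> of a merely continuous form need not pass to weak limits; this is what
  weak continuity is for. The linear terms pass without it. Since \<open>c\<close> is given on Z
  only, the Galerkin spaces have to lie in Z, and their generators come from a dense sequence of Z.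
  Z stays a subset of the product space throughout; Hahn--Banach extends functionals from Z to that
  space and also shows that Z is weakly closed. Reflexivity always enters in the same way: a
  functional on the dual is evaluation at a point. The constants come from testing with
  \<open>z\<close> itself: \<open>c(z, z, z) = 0\<close> leaves \<open>c_a |z|^2 <= F z\<close>, so
  \<open>|z| <= |F| / c_a\<close>. The residual then has norm at most
  \<open>C_a |z| + C_c |z|^2 + |F|\<close>, and the inf-sup condition contributes the factor
  \<open>1 / c_b\<close>.\<close>

lemma Hahn_Banach_graph_step:
  fixes M :: "('a::real_normed_vector \<times> real) set"
  assumes M: "subspace M" and bound: "\<And>x r. (x, r) \<in> M \<Longrightarrow> r \<le> K * norm x" and K: "K \<ge> 0"
  shows "\<exists>s. \<forall>(x, r) \<in> span (insert (y, s) M). r \<le> K * norm x"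
proof -
  \<comment> \<open>The admissible values form the interval from this supremum to the infimum of
    \<open>K * norm (x + y) - r\<close>; \<open>sep\<close> says that it is nonempty. Elements of
    the span with \<open>t > 0\<close> need the upper end, those with \<open>t < 0\<close> the lower
    one.\<close>
  define s where "s = (SUP m\<in>M. snd m - K * norm (fst m - y))"
  have sep: "r' - K * norm (x' - y) \<le> K * norm (x + y) - r"
    if "(x, r) \<in> M" "(x', r') \<in> M" for x x' r r'
  proof -
    have "(x, r) + (x', r') \<in> M" using M that by (rule subspace_add)
    then have "r + r' \<le> K * norm (x + x')" using bound by simp
    also have "\<dots> \<le> K * norm (x + y) + K * norm (x' - y)"
      using norm_triangle_ineq[of "x + y" "x' - y"] K
      by (metis add.commute add_diff_cancel diff_add_eq distrib_left group_cancel.add1 mult_left_mono)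
    finally show ?thesis by simp
  qed
  have M0: "(0, 0) \<in> M" using subspace_0[OF M] by (simp add: zero_prod_def)
  have "bdd_above ((\<lambda>m. snd m - K * norm (fst m - y)) ` M)"
    using sep[OF M0] by (intro bdd_aboveI2[of _ _ "K * norm (0 + y) - 0"]) auto
  then have lower: "r - K * norm (x - y) \<le> s" if "(x, r) \<in> M" for x r
    using that unfolding s_def by (force intro: cSUP_upper2)
  have upper: "s \<le> K * norm (x + y) - r" if "(x, r) \<in> M" for x r
    unfolding s_def using sep[OF that] M0 by (intro cSUP_least) auto
  show ?thesis
  proof (intro exI ballI, clarify)
    fix z q assume "(z, q) \<in> span (insert (y, s) M)"
    then obtain t where t: "(z, q) - t *\<^sub>R (y, s) \<in> M"
      using span_breakdown_eq span_eq_iff M by metis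
    define x r where "x = z - t *\<^sub>R y" and "r = q - t * s"
    have xr: "(x, r) \<in> M" and zq: "z = x + t *\<^sub>R y" "q = r + t * s"
      using t by (simp_all add: x_def r_def)
    have scaled: "(x /\<^sub>R u, r / u) \<in> M" for u
      using subspace_scale[OF M xr, of "inverse u"] by (simp add: field_simps)
    consider "t = 0" | "t > 0" | "t < 0" by linarith
    then show "q \<le> K * norm z"
    proof cases
      case 1
      then show ?thesis using bound[OF xr] zq by simp
    next
      case 2
      have "r + t * s \<le> t * (K * norm (x /\<^sub>R t + y))"
        using mult_left_mono[OF upper[OF scaled[of t]], of t] 2 by (simp add: right_diff_distrib)
      also have "\<dots> = K * norm (t *\<^sub>R (x /\<^sub>R t + y))"
        using 2 by simp
      finally show ?thesis using 2 zq by (simp add: scaleR_add_right)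
    next
      case 3
      have "r + t * s \<le> - t * (K * norm (x /\<^sub>R (- t) - y))"
        using mult_left_mono[OF lower[OF scaled[of "- t"]], of "- t"] 3 by (simp add: right_diff_distrib)
      also have "\<dots> = K * norm ((- t) *\<^sub>R (x /\<^sub>R (- t) - y))"
        using 3 by simp
      finally show ?thesis using 3 zq by (simp add: scaleR_diff_right)
    qed
  qed
qed

text \<open>Zorn's lemma on graphs, so that extending a functional is inclusion of subspaces. That a
  graph is single-valued need not be imposed: two values over \<open>x\<close> give
  \<open>(0, r - r')\<close> and its negative, and the bound at 0 is 0. Closure under negation also
  turns the one-sided bound into one for the absolute value.\<close>

theorem Hahn_Banach:
  fixes V :: "'a::real_normed_vector set"
  assumes V: "subspace V" and f: "linear_form_on V f"
    and bound: "\<And>x. x \<in> V \<Longrightarrow> \<bar>f x\<bar> \<le> K * norm x" and K: "K \<ge> 0"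
  obtains g :: "'a \<Rightarrow>\<^sub>L real" where "\<And>x. x \<in> V \<Longrightarrow> g x = f x" "norm g \<le> K"
proof -
  define \<A> where "\<A> = {M :: ('a \<times> real) set. subspace M \<and> (\<lambda>x. (x, f x)) ` V \<subseteq> M \<and>
                          (\<forall>(x, r)\<in>M. r \<le> K * norm x)}"
  let ?G = "(\<lambda>x. (x, f x)) ` V"
  have f_add: "f (x + y) = f x + f y" and f_scale: "f (r *\<^sub>R x) = r * f x" if "x \<in> V" "y \<in> V" for x y r
    using f that by (auto simp: linear_form_on_def)
  have "f 0 = 0" using f_scale[OF subspace_0[OF V] subspace_0[OF V], of 0] by simp
  then have "subspace ?G"
    using subspace_0[OF V] subspace_add[OF V] subspace_scale[OF V] f_add f_scale
    by (auto simp: subspace_def zero_prod_def image_iff)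
  moreover have "\<forall>(x, r)\<in>?G. r \<le> K * norm x" using bound by fastforce
  ultimately have "?G \<in> \<A>" by (auto simp: \<A>_def)
  moreover have "\<Union>\<C> \<in> \<A>" if "\<C> \<noteq> {}" "subset.chain \<A> \<C>" for \<C>
  proof -
    have sub: "subspace M" "?G \<subseteq> M" "\<And>x r. (x, r) \<in> M \<Longrightarrow> r \<le> K * norm x" if "M \<in> \<C>" for M
      using that \<open>subset.chain \<A> \<C>\<close> by (auto simp: subset_chain_def \<A>_def)
    have "subspace (\<Union>\<C>)"
      unfolding subspace_def
    proof (intro conjI ballI allI)
      show "0 \<in> \<Union>\<C>" using that(1) sub(1) subspace_0 by blast
      show "c *\<^sub>R x \<in> \<Union>\<C>" if "x \<in> \<Union>\<C>" for c x
        using that sub(1) subspace_scale by blast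
      show "x + y \<in> \<Union>\<C>" if xy: "x \<in> \<Union>\<C>" "y \<in> \<Union>\<C>" for x y
      proof -
        obtain M N where "M \<in> \<C>" "N \<in> \<C>" "x \<in> M" "y \<in> N" using xy by blast
        moreover then have "M \<subseteq> N \<or> N \<subseteq> M"
          using \<open>subset.chain \<A> \<C>\<close> by (auto simp: subset_chain_def)
        ultimately obtain L where "L \<in> \<C>" "x \<in> L" "y \<in> L" by blast
        then show ?thesis using sub(1)[of L] subspace_add by blast
      qed
    qed
    moreover have "?G \<subseteq> \<Union>\<C>" using that(1) sub(2) by blast
    ultimately show ?thesis using sub(3) by (auto simp: \<A>_def)
  qed
  ultimately obtain M where M: "M \<in> \<A>" and max: "\<And>N. N \<in> \<A> \<Longrightarrow> M \<subseteq> N \<Longrightarrow> N = M"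
    using subset_Zorn_nonempty[of \<A>] by blast
  have subM: "subspace M" and GM: "?G \<subseteq> M" and boundM: "\<And>x r. (x, r) \<in> M \<Longrightarrow> r \<le> K * norm x"
    using M by (auto simp: \<A>_def)
  have total: "\<exists>r. (y, r) \<in> M" for y
  proof -
    obtain s where s: "\<forall>(x, r) \<in> span (insert (y, s) M). r \<le> K * norm x"
      using Hahn_Banach_graph_step[OF subM boundM K, of y] by blast
    have "M \<subseteq> span (insert (y, s) M)" by (rule order_trans[OF subset_insertI span_superset])
    moreover from this have "span (insert (y, s) M) \<in> \<A>" using s GM by (auto simp: \<A>_def)
    ultimately have "span (insert (y, s) M) = M" using max by blast
    then show ?thesis using span_base[of "(y, s)" "insert (y, s) M"] by auto
  qed
  have unique: "r = r'" if "(x, r) \<in> M" "(x, r') \<in> M" for x r r'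
    using boundM[of 0 "r - r'"] boundM[of 0 "r' - r"]
      subspace_diff[OF subM that] subspace_diff[OF subM that(2,1)] by simp
  obtain h where h: "\<And>y. (y, h y) \<in> M" using total by metis
  have h_eq: "h x = r" if "(x, r) \<in> M" for x r using unique[OF h that] .
  have hb: "\<bar>h x\<bar> \<le> norm x * K" for x
    using boundM[OF h[of x]] boundM[of "- x" "- h x"] subspace_neg[OF subM h[of x]]
    by (auto simp: mult.commute)
  have "bounded_linear h"
  proof (rule bounded_linear_intro)
    show "h (x + y) = h x + h y" for x y
      using subspace_add[OF subM h[of x] h[of y]] by (intro h_eq) simp
    show "h (r *\<^sub>R x) = r *\<^sub>R h x" for r x
      using subspace_scale[OF subM h[of x], of r] by (intro h_eq) simp
    show "norm (h x) \<le> norm x * K" for x using hb by simp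
  qed
  then have h_apply: "blinfun_apply (Blinfun h) = h" by (rule bounded_linear_Blinfun_apply)
  show thesis
  proof (rule that)
    show "Blinfun h x = f x" if "x \<in> V" for x
      using GM that by (auto simp: h_apply intro!: h_eq)
    show "norm (Blinfun h) \<le> K"
      using hb K by (intro norm_blinfun_bound) (auto simp: h_apply mult.commute)
  qed
qed

text \<open>This lets weak convergence in a subspace, which is tested with functionals defined there
  only, be checked with functionals on the whole space.\<close>

corollary bounded_linear_form_on_extend:
  fixes V :: "'a::real_normed_vector set"
  assumes "subspace V" and "bounded_linear_form_on V f"
  obtains g :: "'a \<Rightarrow>\<^sub>L real" where "\<And>x. x \<in> V \<Longrightarrow> g x = f x"
proof -
  obtain K where "\<And>x. x \<in> V \<Longrightarrow> \<bar>f x\<bar> \<le> K * norm x"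
    using assms(2) by (auto simp: bounded_linear_form_on_def)
  \<comment> \<open>\<open>K\<close> may be negative when \<open>V\<close> is trivial.\<close>
  then have "\<bar>f x\<bar> \<le> \<bar>K\<bar> * norm x" if "x \<in> V" for x
    using that by (meson abs_ge_self mult_right_mono norm_ge_zero order_trans)
  with assms show thesis
    using Hahn_Banach[of V f "\<bar>K\<bar>"] that by (auto simp: bounded_linear_form_on_def)
qed

text \<open>
  On the span of \<open>V\<close> and \<open>y\<close> take the functional \<open>v + t y \<mapsto> t\<close>; it is bounded because
  \<open>|v + t y| = |t| |y - (- v / t)|\<close> and \<open>y\<close> has positive distance from \<open>V\<close>.
\<close>
corollary Hahn_Banach_separation:
  fixes V :: "'a::real_normed_vector set"
  assumes V: "subspace V" and y: "y \<notin> closure V"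
  obtains g :: "'a \<Rightarrow>\<^sub>L real" where "\<And>x. x \<in> V \<Longrightarrow> g x = 0" "g y \<noteq> 0"
proof -
  obtain d where d: "d > 0" "\<And>v. v \<in> V \<Longrightarrow> d \<le> dist v y"
    using y by (meson closure_approachable not_less)
  \<comment> \<open>The coefficient of \<open>y\<close>. It is unique because two different values
    would put a nonzero multiple of \<open>y\<close>, hence \<open>y\<close>, into
    \<open>V\<close>.\<close>
  define f where "f = (\<lambda>x. THE t. x - t *\<^sub>R y \<in> V)"
  have f_eq: "f x = t" if "x - t *\<^sub>R y \<in> V" for x t
    unfolding f_def
  proof (rule the_equality)
    fix t' assume "x - t' *\<^sub>R y \<in> V"
    from subspace_diff[OF V this that] have "(t - t') *\<^sub>R y \<in> V" by (simp add: algebra_simps)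
    then have "t \<noteq> t' \<Longrightarrow> y \<in> V"
      using subspace_scale[OF V, of "(t - t') *\<^sub>R y" "inverse (t - t')"] by simp
    then show "t' = t" using y closure_subset by blast
  qed (fact that)
  let ?W = "span (insert y V)"
  have f_in: "x - f x *\<^sub>R y \<in> V" if "x \<in> ?W" for x
    using that f_eq V by (metis span_breakdown_eq span_eq_iff)
  have "linear_form_on ?W f"
    unfolding linear_form_on_def
  proof (intro conjI ballI allI)
    show "f (x + z) = f x + f z" if "x \<in> ?W" "z \<in> ?W" for x z
      using subspace_add[OF V f_in[OF that(1)] f_in[OF that(2)]]
      by (intro f_eq) (simp add: algebra_simps)
    show "f (r *\<^sub>R x) = r * f x" if "x \<in> ?W" for r x
      using subspace_scale[OF V f_in[OF that], of r] by (intro f_eq) (simp add: algebra_simps)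
  qed
  moreover have "\<bar>f x\<bar> \<le> inverse d * norm x" if "x \<in> ?W" for x
  proof (cases "f x = 0")
    case False
    define v where "v = (- inverse (f x)) *\<^sub>R (x - f x *\<^sub>R y)"
    have "v \<in> V" unfolding v_def by (intro subspace_scale[OF V] f_in that)
    moreover have "v - y = (- inverse (f x)) *\<^sub>R x"
      using False by (simp add: v_def algebra_simps)
    ultimately have "d \<le> norm x / \<bar>f x\<bar>"
      using d(2)[of v] by (simp add: dist_norm divide_inverse mult.commute)
    then show ?thesis using False d(1) by (simp add: field_simps)
  qed (use d in simp)
  ultimately obtain g :: "'a \<Rightarrow>\<^sub>L real" where g: "\<And>x. x \<in> ?W \<Longrightarrow> g x = f x"
    using Hahn_Banach[OF subspace_span, of "insert y V" f "inverse d"] d(1) by (metis inverse_nonnegative_iff_nonnegative less_imp_le)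
  show thesis
  proof (rule that)
    show "g x = 0" if "x \<in> V" for x
      using g[of x] f_eq[of x 0] that by (simp add: span_base)
    show "g y \<noteq> 0"
      using g[of y] f_eq[of y 1] subspace_0[OF V] by (simp add: span_base)
  qed
qed

corollary ex_norming_functional:
  fixes x :: "'a::real_normed_vector"
  obtains f :: "'a \<Rightarrow>\<^sub>L real" where "norm f \<le> 1" "f x = norm x"
proof -
  \<comment> \<open>Describing the value instead of the coefficient covers \<open>x = 0\<close>:
    there \<open>t\<close> is arbitrary, but \<open>t * norm x\<close> is still unique.\<close>
  define h where "h = (\<lambda>y. THE r. \<exists>t. y = t *\<^sub>R x \<and> r = t * norm x)"
  have h: "h (t *\<^sub>R x) = t * norm x" for t
    unfolding h_def by (rule the_equality) auto
  have "linear_form_on (span {x}) h"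
    unfolding linear_form_on_def
  proof (intro conjI ballI allI)
    fix y z r assume "y \<in> span {x}" "z \<in> span {x}"
    then obtain s t where st: "y = s *\<^sub>R x" "z = t *\<^sub>R x"
      by (auto simp: span_singleton)
    show "h (y + z) = h y + h z"
      using h[of "s + t"] by (simp add: st h algebra_simps)
    show "h (r *\<^sub>R y) = r * h y"
      using h[of "r * s"] by (simp add: st h)
  qed
  moreover have "\<bar>h y\<bar> \<le> 1 * norm y" if "y \<in> span {x}" for y
    using that by (auto simp: span_singleton h abs_mult)
  ultimately obtain g :: "'a \<Rightarrow>\<^sub>L real" where "\<And>y. y \<in> span {x} \<Longrightarrow> g y = h y" "norm g \<le> 1"
    using Hahn_Banach[of "span {x}" h 1] by auto
  moreover have "h x = norm x" using h[of 1] by simp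
  ultimately show thesis using that[of g] by (simp add: span_base)
qed

section \<open>Separability, reflexivity and weak compactness\<close>

text \<open>A countable dense set of the product may miss \<open>Z\<close>. So for each of its
  points \<open>d\<close> and each \<open>k\<close>, a point of \<open>Z\<close> within
  \<open>1 / (k + 1)\<close> of \<open>d\<close> is chosen where there is one, and the default
  \<open>z0\<close> otherwise.\<close>

lemma dense_sequence_in:
  fixes Z :: "('g::real_normed_vector \<times> 'u::real_normed_vector) set"
  assumes "separable_space (euclidean :: 'g topology)" "separable_space (euclidean :: 'u topology)"
    and "Z \<noteq> {}"
  obtains e :: "nat \<Rightarrow> 'g \<times> 'u" where "range e \<subseteq> Z" "Z \<subseteq> closure (range e)"
proof -
  obtain A B where A: "countable A" "closure A = (UNIV :: 'g set)"
    and B: "countable B" "closure B = (UNIV :: 'u set)"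
    using assms by (auto simp: separable_space_def)
  define D where "D = A \<times> B"
  have D: "countable D" "closure D = UNIV"
    using A B by (simp_all add: D_def closure_Times)
  obtain z0 where z0: "z0 \<in> Z" using assms(3) by blast
  define p where "p = (\<lambda>(d, k). if \<exists>z\<in>Z. dist z d < 1 / real (Suc k)
                             then SOME z. z \<in> Z \<and> dist z d < 1 / real (Suc k) else z0)"
  have p: "p (d, k) \<in> Z \<and> dist (p (d, k)) d < 1 / real (Suc k)"
    if "z \<in> Z" "dist z d < 1 / real (Suc k)" for z d k
    unfolding p_def prod.case using that someI[of "\<lambda>z. z \<in> Z \<and> dist z d < 1 / real (Suc k)" z] by auto
  have pZ: "p x \<in> Z" for x
  proof (cases "\<exists>z\<in>Z. dist z (fst x) < 1 / real (Suc (snd x))")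
    case True
    then show ?thesis using p[of _ "fst x" "snd x"] by auto
  next
    case False
    then show ?thesis using z0 by (simp only: p_def split_beta if_False)
  qed
  define P where "P = p ` (D \<times> UNIV)"
  have "countable P" unfolding P_def using D(1) by simp
  moreover have "P \<noteq> {}" using D by (auto simp: P_def)
  ultimately obtain e :: "nat \<Rightarrow> _" where e: "range e = P"
    by (metis from_nat_into range_from_nat_into)
  have "P \<subseteq> Z" unfolding P_def using pZ by auto
  moreover have "z \<in> closure P" if z: "z \<in> Z" for z
    unfolding closure_approachable
  proof (intro allI impI)
    fix r :: real assume "r > 0"
    then obtain k where k: "1 / real (Suc k) < r / 2" using nat_approx_posE[of "r / 2"] by auto
    obtain d where d: "d \<in> D" "dist d z < 1 / real (Suc k)"
      using D(2) closure_approachable[of z D] by (metis UNIV_I of_nat_0_less_iff zero_less_Suc zero_less_divide_1_iff)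
    have "dist (p (d, k)) z \<le> dist (p (d, k)) d + dist d z" by (rule dist_triangle)
    then have "dist (p (d, k)) z < r"
      using p[OF z, of d k] d(2) k by (simp add: dist_commute)
    then show "\<exists>y\<in>P. dist y z < r" using d(1) by (auto simp: P_def)
  qed
  ultimately show thesis using that[of e] e by blast
qed

lemma reflexive_spaceE:
  fixes \<Phi> :: "('a::real_normed_vector \<Rightarrow>\<^sub>L real) \<Rightarrow>\<^sub>L real"
  assumes "reflexive_space TYPE('a)"
  obtains x :: 'a where "\<And>f :: 'a \<Rightarrow>\<^sub>L real. blinfun_apply \<Phi> f = f x"
  using assms unfolding reflexive_space_def by blast

text \<open>Each functional on the product is the sum of one in the first and one in the second
  variable. Composing \<open>\<Phi>\<close> with the two pullbacks gives elements of the biduals of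
  the factors, represented by \<open>x\<close> and \<open>y\<close>.\<close>

lemma reflexive_space_prod:
  assumes "reflexive_space TYPE('a::real_normed_vector)" and "reflexive_space TYPE('b::real_normed_vector)"
  shows "reflexive_space TYPE('a \<times> 'b)"
  unfolding reflexive_space_def
proof
  fix \<Phi> :: "(('a \<times> 'b) \<Rightarrow>\<^sub>L real) \<Rightarrow>\<^sub>L real"
  have 1: "bounded_linear (\<lambda>f :: 'a \<Rightarrow>\<^sub>L real. \<Phi> (f o\<^sub>L fst_blinfun))"
    and 2: "bounded_linear (\<lambda>f :: 'b \<Rightarrow>\<^sub>L real. \<Phi> (f o\<^sub>L snd_blinfun))"
    by (intro bounded_linear_compose[OF blinfun.bounded_linear_right]
          bounded_bilinear.bounded_linear_left[OF bounded_bilinear_blinfun_compose])+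
  obtain x :: 'a where x: "\<And>f :: 'a \<Rightarrow>\<^sub>L real. \<Phi> (f o\<^sub>L fst_blinfun) = f x"
    using reflexive_spaceE[OF assms(1), of "Blinfun (\<lambda>f. \<Phi> (f o\<^sub>L fst_blinfun))"]
    by (auto simp: bounded_linear_Blinfun_apply[OF 1])
  obtain y :: 'b where y: "\<And>f :: 'b \<Rightarrow>\<^sub>L real. \<Phi> (f o\<^sub>L snd_blinfun) = f y"
    using reflexive_spaceE[OF assms(2), of "Blinfun (\<lambda>f. \<Phi> (f o\<^sub>L snd_blinfun))"]
    by (auto simp: bounded_linear_Blinfun_apply[OF 2])
  have "\<Phi> f = f (x, y)" for f
  proof -
    define f1 where "f1 = Blinfun (\<lambda>x. f (x, 0))"
    define f2 where "f2 = Blinfun (\<lambda>y. f (0, y))"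
    have f1: "f1 x = f (x, 0)" for x
      unfolding f1_def
      by (subst bounded_linear_Blinfun_apply) (auto intro!: bounded_linear_intros bounded_linear_Pair)
    have f2: "f2 y = f (0, y)" for y
      unfolding f2_def
      by (subst bounded_linear_Blinfun_apply) (auto intro!: bounded_linear_intros bounded_linear_Pair)
    have "f = (f1 o\<^sub>L fst_blinfun) + (f2 o\<^sub>L snd_blinfun)"
      by (rule blinfun_eqI) (auto simp: blinfun.add_left f1 f2 simp flip: blinfun.add_right)
    then have "\<Phi> f = \<Phi> (f1 o\<^sub>L fst_blinfun) + \<Phi> (f2 o\<^sub>L snd_blinfun)"
      using blinfun.add_right by metis
    also have "\<dots> = f (x, y)"
      by (simp add: x y f1 f2 flip: blinfun.add_right)
    finally show ?thesis .
  qed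
  then show "\<exists>x. \<forall>f. \<Phi> f = blinfun_apply f x" by blast
qed

text \<open>Tychonoff's theorem in place of a diagonal argument: the box is compact in the countable
  product, which is first countable, hence sequentially compact.\<close>

lemma bounded_coordinates_subseq:
  fixes X :: "nat \<Rightarrow> nat \<Rightarrow> real"
  assumes "\<And>k i. \<bar>X k i\<bar> \<le> B i"
  obtains r where "strict_mono r" "\<And>i. convergent (\<lambda>k. X (r k) i)"
proof -
  have "compactin (product_topology (\<lambda>i. euclidean) UNIV) (PiE UNIV (\<lambda>i. {- B i..B i}))"
    by (simp add: compactin_PiE)
  then have "compact (PiE UNIV (\<lambda>i. {- B i..B i}))"
    by (simp add: euclidean_product_topology)
  then have "seq_compact (PiE UNIV (\<lambda>i. {- B i..B i}))"
    by (rule compact_imp_seq_compact)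
  moreover have "\<forall>k. X k \<in> PiE UNIV (\<lambda>i. {- B i..B i})"
    using assms by (auto simp: abs_le_iff minus_le_iff)
  ultimately obtain l r where r: "strict_mono r" "(X \<circ> r) \<longlonglongrightarrow> l"
    unfolding seq_compact_def by blast
  have "(\<lambda>k. X (r k) i) \<longlonglongrightarrow> l i" for i
    using continuous_on_tendsto_compose[OF continuous_on_product_coordinates r(2), of i]
    by (simp add: o_def)
  then show thesis using that r(1) convergentI by blast
qed

text \<open>
  Countably many norming functionals span a dense subspace of the dual: a functional on the dual
  that vanishes on them all is evaluation at some \<open>x\<close>, and no dense vector can be close to \<open>x \<noteq> 0\<close>.
\<close>
lemma dense_functionals:
  fixes d :: "nat \<Rightarrow> 'a::real_normed_vector"
  assumes refl: "reflexive_space TYPE('a)" and d: "closure (range d) = UNIV"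
  obtains f :: "nat \<Rightarrow> ('a \<Rightarrow>\<^sub>L real)" where "closure (span (range f)) = UNIV"
proof -
  have "\<exists>f :: 'a \<Rightarrow>\<^sub>L real. norm f \<le> 1 \<and> blinfun_apply f (d k) = norm (d k)" for k
    using ex_norming_functional by metis
  then obtain f :: "nat \<Rightarrow> ('a \<Rightarrow>\<^sub>L real)"
    where f: "\<And>k. norm (f k) \<le> 1" "\<And>k. blinfun_apply (f k) (d k) = norm (d k)"
    by metis
  have "g \<in> closure (span (range f))" for g
  proof (rule ccontr)
    assume g: "g \<notin> closure (span (range f))"
    obtain \<Phi> :: "('a \<Rightarrow>\<^sub>L real) \<Rightarrow>\<^sub>L real"
      where \<Phi>: "\<And>h. h \<in> span (range f) \<Longrightarrow> \<Phi> h = 0" "\<Phi> g \<noteq> 0"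
      using Hahn_Banach_separation[OF subspace_span g] by blast
    obtain x where x: "\<And>h. \<Phi> h = blinfun_apply h x"
      using reflexive_spaceE[OF refl] by blast
    have "x \<noteq> 0" using \<Phi>(2) by (auto simp: x blinfun.zero_right)
    \<comment> \<open>Half the norm suffices: \<open>f k x = 0\<close> will give
      \<open>norm (d k) \<le> norm (d k - x)\<close>, so that \<open>norm x\<close> is at most twice
      this distance.\<close>
    then obtain k where k: "norm (d k - x) < norm x / 2"
      using closure_approachable[of x "range d"] d
      by (metis UNIV_I dist_norm half_gt_zero rangeE zero_less_norm_iff)
    have "f k x = 0"
      using \<Phi>(1)[of "f k"] x span_base by (metis rangeI)
    then have "norm (d k) = f k (d k - x)" by (simp add: f blinfun.diff_right)
    also have "\<dots> \<le> norm (f k) * norm (d k - x)"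
      using norm_blinfun[of "f k" "d k - x"] by simp
    also have "\<dots> \<le> norm (d k - x)"
      using f(1)[of k] by (simp add: mult_left_le_one_le)
    finally show False
      using k norm_triangle_ineq2[of x "x - d k"] by (simp add: norm_minus_commute)
  qed
  then show thesis using that by blast
qed

text \<open>An approximation of \<open>g\<close> in the dual norm is uniform along a bounded
  sequence, so the Cauchy property carries over from the span.\<close>

lemma convergent_of_dense_functionals:
  fixes f :: "nat \<Rightarrow> ('a::real_normed_vector \<Rightarrow>\<^sub>L real)" and g :: "'a \<Rightarrow>\<^sub>L real"
  assumes dense: "closure (span (range f)) = UNIV"
    and conv: "\<And>k. convergent (\<lambda>n. f k (z n))" and z: "\<And>n. norm (z n) \<le> B"
  shows "convergent (\<lambda>n. blinfun_apply g (z n))"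
proof -
  have span: "convergent (\<lambda>n. blinfun_apply h (z n))" if "h \<in> span (range f)" for h
    using that
  proof (induction rule: span_induct)
    case base
    show ?case
      by (auto simp: subspace_def blinfun.add_left blinfun.scaleR_left
          intro: convergent_add convergent_mult convergent_const)
  qed (use conv in auto)
  have B: "B \<ge> 0" using z[of 0] norm_ge_zero order_trans by blast
  have "Cauchy (\<lambda>n. g (z n))"
  proof (rule metric_CauchyI)
    fix e :: real assume e: "e > 0"
    \<comment> \<open>\<open>B + 1\<close> instead of \<open>B\<close> allows \<open>B = 0\<close>
      and makes \<open>\<eta> * B < e / 3\<close> strict.\<close>
    define \<eta> where "\<eta> = e / (3 * (B + 1))"
    have \<eta>: "\<eta> > 0" "\<eta> * B < e / 3"
      using e B by (auto simp: \<eta>_def field_simps)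
    obtain h where h: "h \<in> span (range f)" "dist h g < \<eta>"
      using dense \<eta>(1) closure_approachable[of g "span (range f)"] by blast
    have close: "\<bar>h (z n) - g (z n)\<bar> < e / 3" for n
    proof -
      have "\<bar>(h - g) (z n)\<bar> \<le> norm (h - g) * norm (z n)"
        using norm_blinfun[of "h - g" "z n"] by simp
      also have "\<dots> \<le> \<eta> * B"
        using h(2) z[of n] \<eta>(1) by (intro mult_mono) (auto simp: dist_norm)
      finally show ?thesis using \<eta>(2) by (simp add: blinfun.diff_left)
    qed
    obtain N where N: "\<And>m n. m \<ge> N \<Longrightarrow> n \<ge> N \<Longrightarrow> dist (h (z m)) (h (z n)) < e / 3"
      using metric_CauchyD[OF convergent_Cauchy[OF span[OF h(1)]], of "e / 3"] e by auto
    show "\<exists>N. \<forall>m\<ge>N. \<forall>n\<ge>N. dist (g (z m)) (g (z n)) < e"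
    proof (intro exI allI impI)
      fix m n assume "m \<ge> N" "n \<ge> N"
      then show "dist (g (z m)) (g (z n)) < e"
        using N[of m n] close[of m] close[of n] unfolding dist_real_def by linarith
    qed
  qed
  then show ?thesis by (simp add: Cauchy_convergent_iff)
qed

text \<open>Convergence on countably many functionals with dense span forces convergence on all of
  them. The limit is then bounded and linear in \<open>g\<close>, that is, an element of the bidual,
  and reflexivity supplies the point.\<close>

theorem reflexive_bounded_weak_subseq:
  fixes d z :: "nat \<Rightarrow> 'a::real_normed_vector"
  assumes refl: "reflexive_space TYPE('a)" and d: "closure (range d) = UNIV"
    and z: "\<And>n. norm (z n) \<le> B"
  shows "\<exists>r x. strict_mono r \<and> (\<forall>g :: 'a \<Rightarrow>\<^sub>L real. (\<lambda>n. g (z (r n))) \<longlonglongrightarrow> g x)"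
proof -
  obtain f :: "nat \<Rightarrow> ('a \<Rightarrow>\<^sub>L real)" where f: "closure (span (range f)) = UNIV"
    using dense_functionals[OF refl d] .
  have bnd: "\<bar>blinfun_apply g (z n)\<bar> \<le> norm g * B" for g n
    using norm_blinfun[of g "z n"] mult_left_mono[OF z[of n], of "norm g"] by simp
  obtain r where r: "strict_mono r" "\<And>k. convergent (\<lambda>n. f k (z (r n)))"
    using bounded_coordinates_subseq[of "\<lambda>n k. f k (z n)" "\<lambda>k. norm (f k) * B"] bnd by blast
  have conv: "(\<lambda>n. g (z (r n))) \<longlonglongrightarrow> lim (\<lambda>n. g (z (r n)))" for g :: "'a \<Rightarrow>\<^sub>L real"
    using convergent_of_dense_functionals[OF f r(2) z] by (simp add: convergent_LIMSEQ_iff)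
  have "bounded_linear (\<lambda>g :: 'a \<Rightarrow>\<^sub>L real. lim (\<lambda>n. g (z (r n))))"
  proof (rule bounded_linear_intro)
    show "lim (\<lambda>n. (g + h) (z (r n))) = lim (\<lambda>n. g (z (r n))) + lim (\<lambda>n. h (z (r n)))"
      for g h :: "'a \<Rightarrow>\<^sub>L real"
      using tendsto_add[OF conv[of g] conv[of h]] by (intro limI) (simp add: blinfun.add_left)
    show "lim (\<lambda>n. (c *\<^sub>R g) (z (r n))) = c *\<^sub>R lim (\<lambda>n. g (z (r n)))"
      for c and g :: "'a \<Rightarrow>\<^sub>L real"
      using tendsto_mult[OF tendsto_const conv[of g], of c]
      by (intro limI) (simp add: blinfun.scaleR_left)
    show "norm (lim (\<lambda>n. g (z (r n)))) \<le> norm g * B" for g :: "'a \<Rightarrow>\<^sub>L real"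
      by (rule LIMSEQ_le_const2[OF tendsto_norm[OF conv[of g]]]) (use bnd in auto)
  qed
  then obtain x where x: "\<And>g :: 'a \<Rightarrow>\<^sub>L real. lim (\<lambda>n. g (z (r n))) = g x"
    using reflexive_spaceE[OF refl, of "Blinfun (\<lambda>g. lim (\<lambda>n. blinfun_apply g (z (r n))))"]
    by (auto simp: bounded_linear_Blinfun_apply)
  have "(\<lambda>n. g (z (r n))) \<longlonglongrightarrow> g x" for g :: "'a \<Rightarrow>\<^sub>L real"
    using conv[of g] unfolding x .
  with r(1) show ?thesis by blast
qed

section \<open>Weakly continuous coercive operators\<close>

text \<open>
  Finite-dimensional existence without fixing the dimension by a type: a solution of the variational
  inequality for \<open>Q\<close> on the cube \<open>[-R, R]\<^sup>n\<close>, whose points are functions \<open>nat \<Rightarrow> real\<close> restricted to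
  \<open>{..<n}\<close>. Label grid points by the sign of \<open>Q\<close>, apply Kuhn's lemma and pass to the limit.
\<close>
lemma cube_variational_inequality:
  fixes Q :: "(nat \<Rightarrow> real) \<Rightarrow> nat \<Rightarrow> real"
  assumes R: "R > 0"
    and cont: "\<And>X x i. i < n \<Longrightarrow> (\<And>j. j < n \<Longrightarrow> (\<lambda>k. X k j) \<longlonglongrightarrow> x j) \<Longrightarrow> (\<lambda>k :: nat. Q (X k) i) \<longlonglongrightarrow> Q x i"
  obtains x where "\<And>i. i < n \<Longrightarrow> Q x i * x i \<le> 0" "\<And>i. i < n \<Longrightarrow> \<bar>x i\<bar> < R \<Longrightarrow> Q x i = 0"
proof -
  define g where "g = (\<lambda>k t (i :: nat). - R + 2 * R * (real (t i) / real (Suc k)))"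
  \<comment> \<open>Label 0 stands for the lower face or \<open>Q \<le> 0\<close>, label 1 for the
    upper face or \<open>Q > 0\<close>. On the faces the label ignores \<open>Q\<close>, as the
    boundary conditions of Kuhn's lemma demand.\<close>
  define lab where "lab = (\<lambda>k t i. if t i = 0 \<or> (t i \<noteq> Suc k \<and> Q (g k t) i \<le> 0) then 0 else 1 :: nat)"
  have "\<exists>q. (\<forall>i<n. q i < Suc k) \<and>
        (\<forall>i<n. \<exists>r s. (\<forall>j<n. q j \<le> r j \<and> r j \<le> q j + 1) \<and> (\<forall>j<n. q j \<le> s j \<and> s j \<le> q j + 1) \<and>
               lab k r i = 0 \<and> lab k s i = 1)" for k
  proof -
    obtain q where q: "\<forall>i<n. q i < Suc k"
      "\<forall>i<n. \<exists>r s. (\<forall>j<n. q j \<le> r j \<and> r j \<le> q j + 1) \<and> (\<forall>j<n. q j \<le> s j \<and> s j \<le> q j + 1) \<and>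
             lab k r i \<noteq> lab k s i"
      by (rule kuhn_lemma[of "Suc k" n "lab k"]) (auto simp: lab_def)
    \<comment> \<open>Kuhn's lemma only says that the two labels differ; as there are just two,
      \<open>r\<close> and \<open>s\<close> can be swapped so that \<open>r\<close> carries label
      0.\<close>
    have "lab k t i = 0 \<or> lab k t i = 1" for t i by (simp add: lab_def)
    then show ?thesis using q by metis
  qed
  then obtain q where q: "\<And>k. \<forall>i<n. q k i < Suc k"
    and "\<And>k. \<forall>i<n. \<exists>r s. (\<forall>j<n. q k j \<le> r j \<and> r j \<le> q k j + 1) \<and>
               (\<forall>j<n. q k j \<le> s j \<and> s j \<le> q k j + 1) \<and> lab k r i = 0 \<and> lab k s i = 1"
    by metis
  note vertices = this(2)
  define near where "near = (\<lambda>k t. \<forall>j<n. q k j \<le> t j \<and> t j \<le> q k j + (1 :: nat))"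
  \<comment> \<open>These vertices depend on the coordinate \<open>i\<close>, but all lie within one
    mesh width of \<open>q k\<close>, so along the subsequence they share the limit
    \<open>x\<close>.\<close>
  define r where "r = (\<lambda>k i. SOME t. near k t \<and> lab k t i = 0)"
  define s where "s = (\<lambda>k i. SOME t. near k t \<and> lab k t i = 1)"
  have r: "near k (r k i) \<and> lab k (r k i) i = 0" if "i < n" for k i
  proof -
    have "\<exists>t. near k t \<and> lab k t i = 0"
      using vertices[of k] that unfolding near_def by blast
    from someI_ex[OF this] show ?thesis unfolding r_def .
  qed
  have s: "near k (s k i) \<and> lab k (s k i) i = 1" if "i < n" for k i
  proof -
    have "\<exists>t. near k t \<and> lab k t i = 1"
      using vertices[of k] that unfolding near_def by blast
    from someI_ex[OF this] show ?thesis unfolding s_def .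
  qed
  \<comment> \<open>\<open>q\<close> is unconstrained from coordinate \<open>n\<close> on, while the
    compactness lemma wants a bound in every coordinate; hence the 0.\<close>
  define X where "X = (\<lambda>k i. if i < n then g k (q k) i else 0)"
  have "\<bar>X k i\<bar> \<le> R" for k i
  proof (cases "i < n")
    case True
    then have "q k i < Suc k" using q by blast
    then have "0 \<le> real (q k i) / real (Suc k)" "real (q k i) / real (Suc k) \<le> 1"
      by simp_all
    then have "0 \<le> 2 * R * (real (q k i) / real (Suc k))"
      and "2 * R * (real (q k i) / real (Suc k)) \<le> 2 * R * 1"
      using R by (intro mult_nonneg_nonneg mult_left_mono; simp)+
    then show ?thesis using True by (simp add: X_def g_def)
  qed (use R in \<open>simp add: X_def\<close>)
  then obtain \<rho> where \<rho>: "strict_mono \<rho>" "\<And>i. convergent (\<lambda>k. X (\<rho> k) i)"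
    using bounded_coordinates_subseq[of X "\<lambda>_. R"] by blast
  then obtain x where x: "\<And>i. (\<lambda>k. X (\<rho> k) i) \<longlonglongrightarrow> x i"
    unfolding convergent_def by metis
  have "(\<lambda>k. 2 * R * inverse (real (Suc k))) \<longlonglongrightarrow> 2 * R * 0"
    by (intro tendsto_mult tendsto_const LIMSEQ_inverse_real_of_nat)
  from LIMSEQ_subseq_LIMSEQ[OF this \<rho>(1)]
  have mesh: "(\<lambda>k. 2 * R * inverse (real (Suc (\<rho> k)))) \<longlonglongrightarrow> 0"
    by (simp add: o_def)
  have lim_near: "(\<lambda>k. g (\<rho> k) (t (\<rho> k)) j) \<longlonglongrightarrow> x j"
    if "j < n" and t: "\<And>k. near k (t k)" for t j
  proof -
    have "(\<lambda>k. g (\<rho> k) (t (\<rho> k)) j - X (\<rho> k) j) \<longlonglongrightarrow> 0"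
    proof (rule Lim_null_comparison[OF always_eventually mesh], intro allI)
      fix k
      have "g (\<rho> k) (t (\<rho> k)) j - X (\<rho> k) j =
              2 * R * (real (t (\<rho> k) j) - real (q (\<rho> k) j)) * inverse (real (Suc (\<rho> k)))"
        using \<open>j < n\<close> by (simp add: X_def g_def divide_inverse algebra_simps)
      moreover have "\<bar>real (t (\<rho> k) j) - real (q (\<rho> k) j)\<bar> \<le> 1"
        using t[of "\<rho> k"] \<open>j < n\<close> unfolding near_def by force
      ultimately show "norm (g (\<rho> k) (t (\<rho> k)) j - X (\<rho> k) j) \<le> 2 * R * inverse (real (Suc (\<rho> k)))"
        using R by (simp add: abs_mult mult_left_le)
    qed
    from tendsto_add[OF this x[of j]] show ?thesis by simp
  qed
  \<comment> \<open>If \<open>Q x i > 0\<close>, then by continuity \<open>Q\<close> is eventually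
    positive at the vertices labelled 0, so their label can only come from the lower face. The upper
    face is the mirror image.\<close>
  have low: "x i = - R \<or> Q x i \<le> 0" if i: "i < n" for i
  proof (rule disjCI)
    assume "\<not> Q x i \<le> 0"
    have lim: "(\<lambda>k. Q (g (\<rho> k) (r (\<rho> k) i)) i) \<longlonglongrightarrow> Q x i"
      by (intro cont[OF i] lim_near) (use r i in auto)
    have "eventually (\<lambda>k. 0 < Q (g (\<rho> k) (r (\<rho> k) i)) i) sequentially"
      using order_tendstoD(1)[OF lim] \<open>\<not> Q x i \<le> 0\<close> by simp
    then have "eventually (\<lambda>k. g (\<rho> k) (r (\<rho> k) i) i = - R) sequentially"
    proof (rule eventually_mono)
      fix k assume "0 < Q (g (\<rho> k) (r (\<rho> k) i)) i"
      then have "r (\<rho> k) i i = 0"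
        using r[OF i, of "\<rho> k"] by (auto simp: lab_def split: if_splits)
      then show "g (\<rho> k) (r (\<rho> k) i) i = - R" by (simp add: g_def)
    qed
    then have "(\<lambda>k. g (\<rho> k) (r (\<rho> k) i) i) \<longlonglongrightarrow> - R"
      by (rule tendsto_eventually)
    moreover have "(\<lambda>k. g (\<rho> k) (r (\<rho> k) i) i) \<longlonglongrightarrow> x i"
      by (rule lim_near) (use r i in auto)
    ultimately show "x i = - R" using LIMSEQ_unique by blast
  qed
  have up: "x i = R \<or> Q x i \<ge> 0" if i: "i < n" for i
  proof (rule disjCI)
    assume "\<not> Q x i \<ge> 0"
    have lim: "(\<lambda>k. Q (g (\<rho> k) (s (\<rho> k) i)) i) \<longlonglongrightarrow> Q x i"
      by (intro cont[OF i] lim_near) (use s i in auto)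
    have "eventually (\<lambda>k. Q (g (\<rho> k) (s (\<rho> k) i)) i < 0) sequentially"
      using order_tendstoD(2)[OF lim] \<open>\<not> Q x i \<ge> 0\<close> by simp
    then have "eventually (\<lambda>k. g (\<rho> k) (s (\<rho> k) i) i = R) sequentially"
    proof (rule eventually_mono)
      fix k assume "Q (g (\<rho> k) (s (\<rho> k) i)) i < 0"
      then have "s (\<rho> k) i i = Suc (\<rho> k)"
        using s[OF i, of "\<rho> k"] by (auto simp: lab_def split: if_splits)
      then show "g (\<rho> k) (s (\<rho> k) i) i = R" by (simp add: g_def)
    qed
    then have "(\<lambda>k. g (\<rho> k) (s (\<rho> k) i) i) \<longlonglongrightarrow> R"
      by (rule tendsto_eventually)
    moreover have "(\<lambda>k. g (\<rho> k) (s (\<rho> k) i) i) \<longlonglongrightarrow> x i"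
      by (rule lim_near) (use s i in auto)
    ultimately show "x i = R" using LIMSEQ_unique by blast
  qed
  show thesis
  proof (rule that)
    fix i assume i: "i < n"
    show "Q x i * x i \<le> 0"
      using low[OF i] up[OF i] R by (auto simp: mult_le_0_iff)
    show "Q x i = 0" if "\<bar>x i\<bar> < R"
      using low[OF i] up[OF i] that by auto
  qed
qed

lemma linear_form_on_sum:
  assumes V: "subspace V" and f: "linear_form_on V f" and e: "\<And>i. i \<in> A \<Longrightarrow> e i \<in> V"
  shows "f (\<Sum>i\<in>A. x i *\<^sub>R e i) = (\<Sum>i\<in>A. x i * f (e i))"
proof -
  have f_add: "f (v + w) = f v + f w" and f_scale: "f (t *\<^sub>R v) = t * f v"
    if "v \<in> V" "w \<in> V" for v w t
    using f that by (auto simp: linear_form_on_def)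
  have "f 0 = 0" using f_scale[OF subspace_0[OF V] subspace_0[OF V], of 0] by simp
  with e show ?thesis
  proof (induction A rule: infinite_finite_induct)
    case (insert i A)
    then have "(\<Sum>i\<in>A. x i *\<^sub>R e i) \<in> V" "e i \<in> V" "x i *\<^sub>R e i \<in> V"
      using V by (auto intro!: subspace_sum subspace_scale)
    then show ?case using insert by (simp add: f_add f_scale)
  qed auto
qed

lemma weakly_converges_inD:
  assumes "weakly_converges_in V x l" "bounded_linear_form_on V f"
  shows "(\<lambda>n. f (x n)) \<longlonglongrightarrow> f l"
  using assms by (simp add: weakly_converges_in_def)

lemma weakly_converges_inI:
  assumes "subspace V" "range x \<subseteq> V" "l \<in> V"
    and "\<And>g :: 'a::real_normed_vector \<Rightarrow>\<^sub>L real. (\<lambda>n. g (x n)) \<longlonglongrightarrow> g l"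
  shows "weakly_converges_in V x l"
  unfolding weakly_converges_in_def
proof (intro conjI allI impI)
  fix f assume "bounded_linear_form_on V f"
  then obtain g :: "'a \<Rightarrow>\<^sub>L real" where "\<And>v. v \<in> V \<Longrightarrow> g v = f v"
    using bounded_linear_form_on_extend[OF assms(1)] by blast
  then show "(\<lambda>n. f (x n)) \<longlonglongrightarrow> f l"
    using assms(2,3) assms(4)[of g] by (simp add: image_subset_iff)
qed (use assms in auto)

text \<open>
  The penalty \<open>\<epsilon> x\<^sub>i\<close> keeps the coefficients bounded even if the \<open>e i\<close> are linearly dependent.
\<close>
lemma penalised_galerkin:
  fixes N :: "'a::real_normed_vector \<Rightarrow> 'a \<Rightarrow> real"
  assumes Z: "subspace Z" and e: "\<And>i :: nat. e i \<in> Z"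
    and lin: "\<And>z. z \<in> Z \<Longrightarrow> linear_form_on Z (N z)"
    and cont: "\<And>zs z y. weakly_converges_in Z zs z \<Longrightarrow> y \<in> Z \<Longrightarrow> (\<lambda>k. N (zs k) y) \<longlonglongrightarrow> N z y"
    and coercive: "\<And>z. z \<in> Z \<Longrightarrow> \<alpha> * (norm z)\<^sup>2 - \<phi> * norm z \<le> N z z"
    and pos: "\<alpha> > 0" "\<phi> \<ge> 0" "\<epsilon> > 0"
  obtains z where "z \<in> Z" "norm z \<le> \<phi> / \<alpha>" "\<And>i. i < n \<Longrightarrow> (N z (e i))\<^sup>2 \<le> \<epsilon> * (\<phi>\<^sup>2 / \<alpha>)"
proof -
  define z where "z = (\<lambda>x :: nat \<Rightarrow> real. \<Sum>j<n. x j *\<^sub>R e j)"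
  have z_eq: "(\<Sum>j<n. x j *\<^sub>R e j) = z x" for x by (simp add: z_def)
  have z: "z x \<in> Z" for x
    unfolding z_def using Z e by (intro subspace_sum subspace_scale)
  define Q where "Q = (\<lambda>x i. N (z x) (e i) + \<epsilon> * x i)"
  define M where "M = \<phi>\<^sup>2 / \<alpha>"
  have M: "M \<ge> 0" using pos by (simp add: M_def)
  \<comment> \<open>The energy estimate will give \<open>(x i)\<^sup>2 \<le> M / \<epsilon>\<close>,
    and \<open>M / \<epsilon> = R - 1 < R \<le> R\<^sup>2\<close>. So the solution stays off the
    faces of the cube and satisfies \<open>Q x i = 0\<close>.\<close>
  define R where "R = M / \<epsilon> + 1"
  have R: "R \<ge> 1" using M pos by (simp add: R_def)
  have Q_cont: "(\<lambda>k :: nat. Q (X k) i) \<longlonglongrightarrow> Q x i"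
    if "i < n" "\<And>j. j < n \<Longrightarrow> (\<lambda>k. X k j) \<longlonglongrightarrow> x j" for X x i
  proof -
    have "(\<lambda>k. z (X k)) \<longlonglongrightarrow> z x"
      unfolding z_def by (intro tendsto_sum tendsto_scaleR tendsto_const that) simp
    then have "weakly_converges_in Z (\<lambda>k. z (X k)) (z x)"
      using z by (intro weakly_converges_inI Z blinfun.tendsto tendsto_const) auto
    then show ?thesis
      unfolding Q_def using that e by (intro tendsto_add cont tendsto_mult tendsto_const) auto
  qed
  obtain x where x: "\<And>i. i < n \<Longrightarrow> Q x i * x i \<le> 0" "\<And>i. i < n \<Longrightarrow> \<bar>x i\<bar> < R \<Longrightarrow> Q x i = 0"
    by (rule cube_variational_inequality[of R n Q]) (use R Q_cont in auto)
  \<comment> \<open>Summing the inequalities amounts to testing \<open>N (z x)\<close> with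
    \<open>z x\<close> itself, which brings coercivity into play; the penalty only adds a
    nonnegative term.\<close>
  have "N (z x) (z x) + \<epsilon> * (\<Sum>i<n. (x i)\<^sup>2) = (\<Sum>i<n. Q x i * x i)"
    using linear_form_on_sum[OF Z lin[OF z], of "{..<n}" e x x] e
    by (simp add: Q_def z_eq sum_distrib_left sum.distrib power2_eq_square algebra_simps)
  also have "\<dots> \<le> 0" using x(1) by (intro sum_nonpos) auto
  finally have energy: "\<alpha> * (norm (z x))\<^sup>2 + \<epsilon> * (\<Sum>i<n. (x i)\<^sup>2) \<le> \<phi> * norm (z x)"
    using coercive[OF z, of x] by linarith
  have "0 \<le> \<epsilon> * (\<Sum>i<n. (x i)\<^sup>2)" using pos by (simp add: sum_nonneg)
  then have "\<alpha> * norm (z x) * norm (z x) \<le> \<phi> * norm (z x)"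
    using energy by (simp add: power2_eq_square)
  then have bound: "norm (z x) \<le> \<phi> / \<alpha>"
    using pos by (cases "norm (z x) = 0") (simp_all add: field_simps)
  have xM: "\<epsilon> * (x i)\<^sup>2 \<le> M" if "i < n" for i
  proof -
    have "(x i)\<^sup>2 \<le> (\<Sum>i<n. (x i)\<^sup>2)" using that by (intro member_le_sum) auto
    then have "\<epsilon> * (x i)\<^sup>2 \<le> \<epsilon> * (\<Sum>i<n. (x i)\<^sup>2)" using pos by simp
    also have "\<dots> \<le> \<phi> * norm (z x)" using energy pos zero_le_power2[of "norm (z x)"]
      by (meson add_increasing less_imp_le mult_nonneg_nonneg order_trans order_refl)
    also have "\<dots> \<le> \<phi> * (\<phi> / \<alpha>)" using bound pos by (intro mult_left_mono) auto
    finally show ?thesis by (simp add: M_def power2_eq_square)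
  qed
  show thesis
  proof (rule that[OF z bound])
    fix i assume i: "i < n"
    have "\<bar>x i\<bar> < R"
    proof (rule ccontr)
      assume "\<not> \<bar>x i\<bar> < R"
      then have "R\<^sup>2 \<le> (x i)\<^sup>2" using R by (metis abs_of_nonneg not_less order_trans zero_le_one abs_le_square_iff)
      also have "\<dots> \<le> M / \<epsilon>" using xM[OF i] pos by (simp add: field_simps)
      finally have "R\<^sup>2 < R" by (simp add: R_def)
      then show False using R self_le_power[of R 2] by simp
    qed
    then have "N (z x) (e i) = - (\<epsilon> * x i)" using x(2)[OF i] by (simp add: Q_def)
    then have "(N (z x) (e i))\<^sup>2 = \<epsilon> * (\<epsilon> * (x i)\<^sup>2)" by (simp add: power2_eq_square)
    also have "\<dots> \<le> \<epsilon> * M" using xM[OF i] pos by (intro mult_left_mono) auto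
    finally show "(N (z x) (e i))\<^sup>2 \<le> \<epsilon> * (\<phi>\<^sup>2 / \<alpha>)" by (simp add: M_def)
  qed
qed

lemma bounded_linear_form_on_tendsto:
  assumes "subspace V" "bounded_linear_form_on V f" "range x \<subseteq> V" "l \<in> V" "x \<longlonglongrightarrow> l"
  shows "(\<lambda>n. f (x n)) \<longlonglongrightarrow> f l"
  by (rule weakly_converges_inD[OF weakly_converges_inI[OF assms(1,3,4)] assms(2)])
     (intro blinfun.tendsto tendsto_const assms(5))

text \<open>The source term is part of \<open>N\<close>, which is why coercivity is asked only up to
  the linear defect \<open>\<phi> * norm z\<close>.\<close>

theorem weakly_continuous_coercive_zero:
  fixes N :: "'a::real_normed_vector \<Rightarrow> 'a \<Rightarrow> real" and d e :: "nat \<Rightarrow> 'a"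
  assumes refl: "reflexive_space TYPE('a)" and d: "closure (range d) = UNIV"
    and Z: "subspace Z" "closed Z" and e: "range e \<subseteq> Z" "Z \<subseteq> closure (range e)"
    and form: "\<And>z. z \<in> Z \<Longrightarrow> bounded_linear_form_on Z (N z)"
    and cont: "\<And>zs z y. weakly_converges_in Z zs z \<Longrightarrow> y \<in> Z \<Longrightarrow> (\<lambda>k. N (zs k) y) \<longlonglongrightarrow> N z y"
    and coercive: "\<And>z. z \<in> Z \<Longrightarrow> \<alpha> * (norm z)\<^sup>2 - \<phi> * norm z \<le> N z z"
    and pos: "\<alpha> > 0" "\<phi> \<ge> 0"
  obtains z where "z \<in> Z" "\<And>y. y \<in> Z \<Longrightarrow> N z y = 0"
proof -
  have lin: "linear_form_on Z (N z)" if "z \<in> Z" for z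
    using form[OF that] by (simp add: bounded_linear_form_on_def)
  \<comment> \<open>With \<open>n\<close> generators and penalty \<open>1 / (n + 1)\<close>, the
    norm bound is independent of \<open>n\<close>, while the residual at each fixed generator tends
    to 0.\<close>
  have "\<exists>z. z \<in> Z \<and> norm z \<le> \<phi> / \<alpha> \<and> (\<forall>i<n. (N z (e i))\<^sup>2 \<le> inverse (real (Suc n)) * (\<phi>\<^sup>2 / \<alpha>))" for n
    by (rule penalised_galerkin[OF Z(1) _ lin cont coercive pos, of e "inverse (real (Suc n))" n])
       (use e in auto)
  then obtain zs where zs: "\<And>n. zs n \<in> Z" "\<And>n. norm (zs n) \<le> \<phi> / \<alpha>"
    "\<And>n i. i < n \<Longrightarrow> (N (zs n) (e i))\<^sup>2 \<le> inverse (real (Suc n)) * (\<phi>\<^sup>2 / \<alpha>)"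
    by metis
  obtain r z where r: "strict_mono r" and z: "\<forall>g :: 'a \<Rightarrow>\<^sub>L real. (\<lambda>n. g (zs (r n))) \<longlonglongrightarrow> g z"
    using reflexive_bounded_weak_subseq[where z = zs, OF refl d zs(2)] by blast
  \<comment> \<open>A closed subspace is weakly closed: a functional separating \<open>z\<close>
    from \<open>Z\<close> vanishes along the whole sequence, hence at its weak limit.\<close>
  have zZ: "z \<in> Z"
  proof (rule ccontr)
    assume "z \<notin> Z"
    then obtain g :: "'a \<Rightarrow>\<^sub>L real" where g: "\<And>y. y \<in> Z \<Longrightarrow> g y = 0" "g z \<noteq> 0"
      using Hahn_Banach_separation[OF Z(1)] closure_closed[OF Z(2)] by metis
    then show False using spec[OF z, of g] zs(1) by (simp add: LIMSEQ_const_iff)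
  qed
  have weak: "weakly_converges_in Z (\<lambda>n. zs (r n)) z"
    using zs(1) zZ z by (intro weakly_converges_inI Z) auto
  have "N z (e i) = 0" for i
  proof -
    have "(\<lambda>n. inverse (real (Suc n)) * (\<phi>\<^sup>2 / \<alpha>)) \<longlonglongrightarrow> 0 * (\<phi>\<^sup>2 / \<alpha>)"
      by (intro tendsto_mult tendsto_const LIMSEQ_inverse_real_of_nat)
    from LIMSEQ_subseq_LIMSEQ[OF this r]
    have rhs: "(\<lambda>n. inverse (real (Suc (r n))) * (\<phi>\<^sup>2 / \<alpha>)) \<longlonglongrightarrow> 0" by (simp add: o_def)
    have lhs: "(\<lambda>n. (N (zs (r n)) (e i))\<^sup>2) \<longlonglongrightarrow> (N z (e i))\<^sup>2"
      using e by (intro tendsto_power cont[OF weak]) auto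
    \<comment> \<open>\<open>r n \<ge> n > i\<close> puts \<open>e i\<close> among the generators of
      the approximate problem.\<close>
    have "\<forall>n\<ge>Suc i. (N (zs (r n)) (e i))\<^sup>2 \<le> inverse (real (Suc (r n))) * (\<phi>\<^sup>2 / \<alpha>)"
      using zs(3) seq_suble[OF r] by (meson Suc_le_lessD less_le_trans)
    then have "(N z (e i))\<^sup>2 \<le> 0" using LIMSEQ_le[OF lhs rhs] by blast
    then show ?thesis by simp
  qed
  then have zero: "N z y = 0" if "y \<in> range e" for y using that by blast
  have "N z y = 0" if y: "y \<in> Z" for y
  proof -
    obtain w where w: "\<And>n. w n \<in> range e" "w \<longlonglongrightarrow> y"
      using y e(2) closure_sequential by (metis subsetD)
    have "(\<lambda>n. N z (w n)) \<longlonglongrightarrow> N z y"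
      using w e(1) y by (intro bounded_linear_form_on_tendsto[OF Z(1) form[OF zZ]]) auto
    then show ?thesis using zero w(1) by (simp add: LIMSEQ_const_iff)
  qed
  with zZ show thesis by (rule that)
qed

section \<open>The saddle point problem\<close>

lemma bounded_linear_imp_form_on:
  assumes "bounded_linear f"
  shows "bounded_linear_form_on V f"
  using bounded_linear.bounded[OF assms] linear_add[OF bounded_linear.linear[OF assms]]
    linear_scale[OF bounded_linear.linear[OF assms]]
  by (auto simp: bounded_linear_form_on_def linear_form_on_def mult.commute)

lemma bounded_linear_form_on_UNIV_iff:
  "bounded_linear_form_on UNIV f \<longleftrightarrow> bounded_linear f"
proof
  assume f: "bounded_linear_form_on UNIV f"
  then obtain K where "\<And>x. \<bar>f x\<bar> \<le> K * norm x"
    by (auto simp: bounded_linear_form_on_def)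
  then show "bounded_linear f"
    using f by (intro bounded_linear_intro[where K = K])
      (simp_all add: bounded_linear_form_on_def linear_form_on_def mult.commute)
qed (rule bounded_linear_imp_form_on)

text \<open>
  The range of \<open>T \<mapsto> b(T, \<cdot>)\<close> is closed because the map is bounded below, and a functional separating
  \<open>L\<close> from it would, by reflexivity, be evaluation at an element of the kernel of \<open>b\<close>.
\<close>
lemma form_kernel_annihilator:
  fixes b :: "'s::banach \<Rightarrow> 'x::real_normed_vector \<Rightarrow> real" and L :: "'x \<Rightarrow>\<^sub>L real"
  assumes b: "bounded_bilinear b" and refl: "reflexive_space TYPE('x)"
    and below: "\<And>T. \<beta> * norm T \<le> norm (Blinfun (b T))" and \<beta>: "\<beta> > 0"
    and L: "\<And>x. x \<in> form_kernel b \<Longrightarrow> L x = 0"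
  obtains S where "\<And>x. b S x = L x"
proof -
  define B where "B = (\<lambda>T. Blinfun (b T))"
  have B: "blinfun_apply (B T) x = b T x" for T x
    unfolding B_def by (simp add: bounded_linear_Blinfun_apply bounded_bilinear.bounded_linear_right[OF b])
  have diff: "B S - B T = B (S - T)" for S T
    by (rule blinfun_eqI) (simp add: blinfun.diff_left B bounded_bilinear.diff_left[OF b])
  have "linear B"
    by (rule linearI; rule blinfun_eqI)
       (simp_all add: B blinfun.add_left blinfun.scaleR_left
          bounded_bilinear.add_left[OF b] bounded_bilinear.scaleR_left[OF b])
  then have sub: "subspace (range B)" by (rule linear_subspace_image) (rule subspace_UNIV)
  have "L \<in> closure (range B)"
  proof (rule ccontr)
    assume "L \<notin> closure (range B)"
    then obtain \<Phi> :: "('x \<Rightarrow>\<^sub>L real) \<Rightarrow>\<^sub>L real"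
      where \<Phi>: "\<And>f. f \<in> range B \<Longrightarrow> \<Phi> f = 0" "\<Phi> L \<noteq> 0"
      using Hahn_Banach_separation[OF sub] by metis
    obtain x where x: "\<And>f. blinfun_apply \<Phi> f = blinfun_apply f x"
      using reflexive_spaceE[OF refl] by metis
    have "b T x = 0" for T using \<Phi>(1)[of "B T"] by (simp add: x B)
    then show False using L[of x] \<Phi>(2) by (simp add: x form_kernel_def)
  qed
  then obtain w where w: "\<And>n. w n \<in> range B" "w \<longlonglongrightarrow> L"
    using closure_sequential by metis
  have "\<forall>n. \<exists>T. w n = B T" using w(1) by blast
  from choice[OF this] obtain T where T: "\<And>n. w n = B (T n)" by blast
  have "Cauchy T"
  proof (rule metric_CauchyI)
    fix e :: real assume "e > 0"
    then obtain N where N: "\<And>m n. m \<ge> N \<Longrightarrow> n \<ge> N \<Longrightarrow> dist (w m) (w n) < \<beta> * e"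
      using metric_CauchyD[OF LIMSEQ_imp_Cauchy[OF w(2)], of "\<beta> * e"] \<beta> by auto
    have "dist (T m) (T n) < e" if "m \<ge> N" "n \<ge> N" for m n
    proof -
      have "\<beta> * dist (T m) (T n) \<le> dist (w m) (w n)"
        using below[of "T m - T n"] by (simp add: dist_norm T diff) (simp add: B_def)
      also have "\<dots> < \<beta> * e" by (rule N[OF that])
      finally show ?thesis using \<beta> by simp
    qed
    then show "\<exists>N. \<forall>m\<ge>N. \<forall>n\<ge>N. dist (T m) (T n) < e" by blast
  qed
  then obtain S where S: "T \<longlonglongrightarrow> S" using Cauchy_convergent convergent_def by blast
  have "b S x = L x" for x
  proof (rule LIMSEQ_unique)
    show "(\<lambda>n. b (T n) x) \<longlonglongrightarrow> b S x"
      by (intro bounded_bilinear.tendsto[OF b] S tendsto_const)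
    show "(\<lambda>n. b (T n) x) \<longlonglongrightarrow> L x"
      using blinfun.tendsto[OF w(2) tendsto_const[of x]] by (simp add: T B)
  qed
  then show thesis by (rule that)
qed

text \<open>Every quotient is at most the dual norm, and \<open>nontrivial\<close> keeps the index
  set of the supremum nonempty. In this form the inf-sup condition yields both the closed range and
  the estimate of the multiplier.\<close>

lemma inf_sup_condition_bounded_below:
  fixes b :: "'s::real_normed_vector \<Rightarrow> 'x::real_normed_vector \<Rightarrow> real"
  assumes b: "bounded_bilinear b" and "inf_sup_condition b \<beta>" and nontrivial: "(x :: 'x) \<noteq> 0"
  shows "\<beta> * norm T \<le> norm (Blinfun (b T))"
proof -
  have "b T y / norm y \<le> norm (Blinfun (b T))" if "y \<noteq> 0" for y
  proof -
    have "b T y \<le> norm (Blinfun (b T)) * norm y"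
      using norm_blinfun[of "Blinfun (b T)" y]
      by (simp add: bounded_linear_Blinfun_apply bounded_bilinear.bounded_linear_right[OF b])
    then show ?thesis using that by (simp add: divide_le_eq)
  qed
  then have "(SUP y\<in>-{0}. b T y / norm y) \<le> norm (Blinfun (b T))"
    using nontrivial by (intro cSUP_least) auto
  moreover have "\<beta> * norm T \<le> (SUP y\<in>-{0}. b T y / norm y)"
    using assms(2) by (simp add: inf_sup_condition_def)
  ultimately show ?thesis by linarith
qed

lemma form_kernel_closed_subspace:
  fixes b :: "'s::real_normed_vector \<Rightarrow> 'x::real_normed_vector \<Rightarrow> real"
  assumes b: "bounded_bilinear b"
  shows "subspace (form_kernel b)" "closed (form_kernel b)"
proof -
  show "subspace (form_kernel b)"
    by (auto simp: subspace_def form_kernel_def bounded_bilinear.zero_right[OF b]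
        bounded_bilinear.add_right[OF b] bounded_bilinear.scaleR_right[OF b])
  have "form_kernel b = (\<Inter>T. {x. b T x = 0})" by (auto simp: form_kernel_def)
  moreover have "closed {x. b T x = 0}" for T
    by (intro closed_Collect_eq continuous_on_const
        linear_continuous_on bounded_bilinear.bounded_linear_right[OF b])
  ultimately show "closed (form_kernel b)" by auto
qed

text \<open>
  The trivial space is treated separately: there the supremum in the inf-sup condition ranges over
  the empty set and is a junk value.
\<close>
theorem weakly_continuous_saddle_point:
  fixes a :: "'x::real_normed_vector \<Rightarrow> 'x \<Rightarrow> real" and b :: "'s::banach \<Rightarrow> 'x \<Rightarrow> real"
    and c :: "'x \<Rightarrow> 'x \<Rightarrow> 'x \<Rightarrow> real" and F :: "'x \<Rightarrow>\<^sub>L real" and d e :: "nat \<Rightarrow> 'x"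
    and c\<^sub>a c\<^sub>b C\<^sub>a C\<^sub>c :: real
  defines "Z \<equiv> form_kernel b"
  assumes refl: "reflexive_space TYPE('x)" and d: "closure (range d) = UNIV"
    and e: "range e \<subseteq> Z" "Z \<subseteq> closure (range e)"
    and a: "bounded_bilinear a" and b: "bounded_bilinear b"
    and c: "bounded_trilinear_form_on Z Z UNIV c"
    and C\<^sub>a: "C\<^sub>a \<ge> 0" "\<And>x y. \<bar>a x y\<bar> \<le> C\<^sub>a * norm x * norm y"
    and C\<^sub>c: "C\<^sub>c \<ge> 0" "\<And>z w y. z \<in> Z \<Longrightarrow> w \<in> Z \<Longrightarrow> \<bar>c z w y\<bar> \<le> C\<^sub>c * norm z * norm w * norm y"
    and pos: "c\<^sub>a > 0" "c\<^sub>b > 0"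
    and coercive: "coercive_on Z a c\<^sub>a" and inf_sup: "inf_sup_condition b c\<^sub>b"
    and skew: "\<And>z. z \<in> Z \<Longrightarrow> c z z z = 0" and weak: "weakly_continuous_into_dual Z c"
  obtains z S where "\<And>y. a z y + c z z y - b S y = F y" "z \<in> Z"
    "norm z \<le> 1 / c\<^sub>a * norm F"
    "norm S \<le> 1 / c\<^sub>b * (1 + C\<^sub>a / c\<^sub>a + C\<^sub>c / c\<^sub>a\<^sup>2 * norm F) * norm F"
proof (cases "\<exists>x :: 'x. x \<noteq> 0")
  case False
  then have "a 0 y + c 0 0 y - b 0 y = F y" for y
    using bounded_bilinear.zero_left[OF a] bounded_bilinear.zero_left[OF b]
      form_kernel_closed_subspace(1)[OF b, THEN subspace_0] skew[of 0]
    by (metis (full_types) Z_def add_0 blinfun.zero_right diff_zero)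
  moreover have "0 \<in> Z" using form_kernel_closed_subspace(1)[OF b] by (simp add: Z_def subspace_0)
  ultimately show ?thesis using pos C\<^sub>a(1) C\<^sub>c(1) by (intro that[of 0 0]) simp_all
next
  case True
  have Z: "subspace Z" "closed Z" unfolding Z_def by (rule form_kernel_closed_subspace[OF b])+
  have c_lin: "bounded_linear (c z w)" if "z \<in> Z" "w \<in> Z" for z w
    using c that C\<^sub>c(2)[OF that]
    by (auto simp: bounded_linear_form_on_UNIV_iff[symmetric] bounded_linear_form_on_def
        bounded_trilinear_form_on_def)
  define N where "N = (\<lambda>z y. a z y + c z z y - F y)"
  have N_lin: "bounded_linear (N z)" if "z \<in> Z" for z
    unfolding N_def
    by (intro bounded_linear_sub bounded_linear_add c_lin that blinfun.bounded_linear_right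
        bounded_bilinear.bounded_linear_right[OF a])
  have N_form: "bounded_linear_form_on Z (N z)" if "z \<in> Z" for z
    by (rule bounded_linear_imp_form_on[OF N_lin[OF that]])
  \<comment> \<open>For fixed \<open>y\<close> the term \<open>a\<close> is a bounded functional of
    its first argument. For \<open>c\<close>, weak convergence in the dual is tested with evaluation
    at \<open>y\<close>.\<close>
  have N_cont: "(\<lambda>k. N (zs k) y) \<longlonglongrightarrow> N z y" if zs: "weakly_converges_in Z zs z" for zs z y
  proof -
    have zsZ: "zs k \<in> Z" "z \<in> Z" for k using zs by (auto simp: weakly_converges_in_def)
    have a_lim: "(\<lambda>k. a (zs k) y) \<longlonglongrightarrow> a z y"
      by (rule weakly_converges_inD[OF zs, where f = "\<lambda>x. a x y"])
         (intro bounded_linear_imp_form_on bounded_bilinear.bounded_linear_left[OF a])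
    have "weakly_converges_in UNIV (\<lambda>k. Blinfun (c (zs k) (zs k))) (Blinfun (c z z))"
      using weak zs by (simp add: weakly_continuous_into_dual_def)
    then have "(\<lambda>k. Blinfun (c (zs k) (zs k)) y) \<longlonglongrightarrow> Blinfun (c z z) y"
      by (rule weakly_converges_inD[where f = "\<lambda>f. blinfun_apply f y"])
         (intro bounded_linear_imp_form_on blinfun.bounded_linear_left)
    then have "(\<lambda>k. c (zs k) (zs k) y) \<longlonglongrightarrow> c z z y"
      by (simp add: bounded_linear_Blinfun_apply c_lin zsZ)
    with a_lim show ?thesis unfolding N_def by (intro tendsto_intros)
  qed
  have N_coercive: "c\<^sub>a * (norm z)\<^sup>2 - norm F * norm z \<le> N z z" if "z \<in> Z" for z
    using coercive skew that norm_blinfun[of F z] by (force simp: coercive_on_def N_def)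
  obtain z where z: "z \<in> Z" "\<And>y. y \<in> Z \<Longrightarrow> N z y = 0"
    by (rule weakly_continuous_coercive_zero[OF refl d Z e N_form N_cont N_coercive pos(1) norm_ge_zero])
       auto
  \<comment> \<open>Taking \<open>y = z\<close> in the limit equation gives the bound without weak
    lower semicontinuity of the norm.\<close>
  have "c\<^sub>a * norm z * norm z \<le> norm F * norm z"
    using N_coercive[OF z(1)] z by (simp add: power2_eq_square)
  then have z_bound: "norm z \<le> norm F / c\<^sub>a"
    using pos by (cases "norm z = 0") (simp_all add: field_simps)
  define L where "L = Blinfun (N z)"
  have L: "L y = N z y" for y
    unfolding L_def by (simp add: bounded_linear_Blinfun_apply N_lin z(1))
  have below: "c\<^sub>b * norm T \<le> norm (Blinfun (b T))" for T
    using inf_sup_condition_bounded_below[OF b inf_sup] True by blast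
  obtain S where S: "\<And>y. b S y = L y"
    by (rule form_kernel_annihilator[OF b refl below pos(2), of L]) (use z L in \<open>auto simp: Z_def\<close>)
  \<comment> \<open>The summands stem from \<open>a\<close>, \<open>c\<close> and \<open>F\<close>.
    Inserting the bound on \<open>norm z\<close> turns them into the terms
    \<open>C\<^sub>a / c\<^sub>a\<close>, \<open>C\<^sub>c / c\<^sub>a\<^sup>2 * norm F\<close> and
    1 of the final factor.\<close>
  have "norm L \<le> C\<^sub>a * norm z + C\<^sub>c * (norm z)\<^sup>2 + norm F"
  proof (rule norm_blinfun_bound)
    show "0 \<le> C\<^sub>a * norm z + C\<^sub>c * (norm z)\<^sup>2 + norm F" using C\<^sub>a(1) C\<^sub>c(1) by simp
    show "norm (L y) \<le> (C\<^sub>a * norm z + C\<^sub>c * (norm z)\<^sup>2 + norm F) * norm y" for y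
      using C\<^sub>a(2)[of z y] C\<^sub>c(2)[OF z(1) z(1), of y] norm_blinfun[of F y]
      by (simp add: L N_def power2_eq_square algebra_simps)
  qed
  also have "\<dots> \<le> C\<^sub>a * (norm F / c\<^sub>a) + C\<^sub>c * (norm F / c\<^sub>a)\<^sup>2 + norm F"
    using z_bound C\<^sub>a(1) C\<^sub>c(1) by (intro add_mono mult_left_mono power_mono) auto
  also have "\<dots> = (1 + C\<^sub>a / c\<^sub>a + C\<^sub>c / c\<^sub>a\<^sup>2 * norm F) * norm F"
    by (simp add: power2_eq_square algebra_simps)
  finally have "norm L \<le> (1 + C\<^sub>a / c\<^sub>a + C\<^sub>c / c\<^sub>a\<^sup>2 * norm F) * norm F" .
  moreover have "Blinfun (b S) = L"
    by (rule blinfun_eqI)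
       (simp add: S bounded_linear_Blinfun_apply bounded_bilinear.bounded_linear_right[OF b])
  ultimately have "c\<^sub>b * norm S \<le> (1 + C\<^sub>a / c\<^sub>a + C\<^sub>c / c\<^sub>a\<^sup>2 * norm F) * norm F"
    using below[of S] by simp
  then have "norm S \<le> 1 / c\<^sub>b * (1 + C\<^sub>a / c\<^sub>a + C\<^sub>c / c\<^sub>a\<^sup>2 * norm F) * norm F"
    using pos(2) by (simp add: pos_le_divide_eq mult.commute)
  moreover have "a z y + c z z y - b S y = F y" for y
    by (simp add: S L N_def)
  ultimately show ?thesis using z(1) z_bound by (intro that[of z S]) simp_all
qed

theorem theorem2p6:
  fixes a :: "'g::banach \<times> 'u::banach \<Rightarrow> 'g \<times> 'u \<Rightarrow> real"
    and b :: "'s::banach \<Rightarrow> 'g \<times> 'u \<Rightarrow> real"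
    and c :: "'g \<times> 'u \<Rightarrow> 'g \<times> 'u \<Rightarrow> 'g \<times> 'u \<Rightarrow> real"
    and c\<^sub>a c\<^sub>b C\<^sub>a C\<^sub>c :: real
  assumes "separable_space (euclidean :: 'g topology)" and "reflexive_space TYPE('g)"
    and "separable_space (euclidean :: 'u topology)" and "reflexive_space TYPE('u)"
    and "separable_space (euclidean :: 's topology)" and "reflexive_space TYPE('s)"
    and "bounded_bilinear a"
    and "bounded_bilinear b"
    and "bounded_trilinear_form_on (form_kernel b) (form_kernel b) UNIV c"
    and "C\<^sub>a \<ge> 0" and "\<forall>x y. \<bar>a x y\<bar> \<le> C\<^sub>a * norm x * norm y"
    and "C\<^sub>c \<ge> 0"
    and "\<forall>z\<in>form_kernel b. \<forall>w\<in>form_kernel b. \<forall>y.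
           \<bar>c z w y\<bar> \<le> C\<^sub>c * norm z * norm w * norm y"
    and "c\<^sub>a > 0" and "c\<^sub>b > 0"
    and "coercive_on (form_kernel b) a c\<^sub>a"
    and "inf_sup_condition b c\<^sub>b"
    and "\<forall>z\<in>form_kernel b. c z z z = 0"
    and "weakly_continuous_into_dual (form_kernel b) c"
  shows "\<forall>F :: ('g \<times> 'u) \<Rightarrow>\<^sub>L real. \<exists>G u S.
           (\<forall>H v. a (G, u) (H, v) + c (G, u) (G, u) (H, v) - b S (H, v)
                  = blinfun_apply F (H, v)) \<and>
           (\<forall>T. b T (G, u) = 0) \<and>
           norm (G, u) \<le> 1 / c\<^sub>a * norm F \<and>
           norm S \<le> 1 / c\<^sub>b * (1 + C\<^sub>a / c\<^sub>a + C\<^sub>c / c\<^sub>a\<^sup>2 * norm F) * norm F"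
proof
  fix F :: "('g \<times> 'u) \<Rightarrow>\<^sub>L real"
  \<comment> \<open>Two dense sequences are needed: \<open>d\<close> in the whole product for weak
    compactness, and \<open>e\<close> inside the kernel for the Galerkin generators.\<close>
  obtain d :: "nat \<Rightarrow> 'g \<times> 'u" where d: "closure (range d) = UNIV"
    using dense_sequence_in[OF assms(1,3), of UNIV] by (metis UNIV_not_empty top.extremum_unique)
  have "form_kernel b \<noteq> {}"
    using form_kernel_closed_subspace(1)[OF assms(8)] subspace_0 by blast
  then obtain e :: "nat \<Rightarrow> 'g \<times> 'u"
    where e: "range e \<subseteq> form_kernel b" "form_kernel b \<subseteq> closure (range e)"
    using dense_sequence_in[OF assms(1,3)] by metis
  obtain z S where zS: "\<And>y. a z y + c z z y - b S y = blinfun_apply F y" "z \<in> form_kernel b"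
    "norm z \<le> 1 / c\<^sub>a * norm F"
    "norm S \<le> 1 / c\<^sub>b * (1 + C\<^sub>a / c\<^sub>a + C\<^sub>c / c\<^sub>a\<^sup>2 * norm F) * norm F"
    by (rule weakly_continuous_saddle_point[OF reflexive_space_prod[OF assms(2,4)] d e assms(7-10)
          _ assms(12) _ assms(14-17) _ assms(19), of F]) (use assms(11,13,18) in auto)
  obtain G u where "z = (G, u)" by (cases z)
  with zS show "\<exists>G u S.
           (\<forall>H v. a (G, u) (H, v) + c (G, u) (G, u) (H, v) - b S (H, v)
                  = blinfun_apply F (H, v)) \<and>
           (\<forall>T. b T (G, u) = 0) \<and>
           norm (G, u) \<le> 1 / c\<^sub>a * norm F \<and>
           norm S \<le> 1 / c\<^sub>b * (1 + C\<^sub>a / c\<^sub>a + C\<^sub>c / c\<^sub>a\<^sup>2 * norm F) * norm F"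
    unfolding form_kernel_def by blast
qed

end
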